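(* Let $\nu_-<\nu_+$ and let $B=B_+\cup B_-$ be a bid-velocity multi-set with $n$ bidders having only the two velocities $\nu_-,\nu_+$. The following two statements are equivalent: (1) the motion attains a periodic increment state, in the sense that there exist $k_0,K\in\mathbb{N}$ ($K\ge1$) and $N\in\mathbb{Z}$ such that $$(T^\gamma)^{k_0+K}B=(T^\gamma)^{k_0}B+\gamma N;$$ (2) $$\frac{|w-\ell|}{n}\cdot h\le\nu_-,\qquad\text{where}\quad h=\frac{n}{\frac{n_-}{\nu_-}+\frac{n_+}{\nu_+}} .$$
   Context: Let $\gamma>0$ be the inverse of a natural number, $p\in[0,1]$ with $np\in\mathbb{N}$; $w=np$ and $\ell=n(1-p)$ are the numbers of winners and losers. A bid-velocity multi-set is $B=[(b_1,v_1),\dots,(b_n,v_n)]$ with $b_1\le\dots\le b_n$, $b_i\in\gamma\mathbb{Z}$ (initially in $[0,1]$); here $v_i\in\{\nu_-,\nu_+\}$ with $0<\nu_-<\nu_+$ integers, $B_\pm=[(b_i,v_i):v_i=\nu_\pm]$, $n_\pm=|B_\pm|\ge1$, $n=n_-+n_+$. One step of the dynamics: set $b'_i=b_i+\gamma v_i(\mathbf{1}\{0<i\le np\}-\mathbf{1}\{np<i\le n\})$, let $\sigma$ be a permutation with $b'_{\sigma_1}\le\dots\le b'_{\sigma_n}$ (ties broken by a fixed deterministic translation-invariant rule, e.g. keeping the previous relative order), and define $T^\gamma B=[(b'_{\sigma_1},v_{\sigma_1}),\dots,(b'_{\sigma_n},v_{\sigma_n})]$. For a real $a$, $B+a=[(b_1+a,v_1),\dots,(b_n+a,v_n)]$.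 *)

theory Defs
  imports Complex_Main "HOL-Combinatorics.Permutations"
begin

text \<open>
  A bid-velocity multi-set is kept as the list \<open>[(b\<^sub>1, v\<^sub>1), \<dots>, (b\<^sub>n, v\<^sub>n)]\<close> ordered by bids, because
  the dynamics depends on the order in which tied bidders are listed.  The list is indexed from \<open>0\<close>,
  so the bidder of rank \<open>i\<close> in the mathematical notation sits at position \<open>i - 1\<close>.
\<close>

type_synonym bid_list = "(real \<times> int) list"

definition bid_velocity_multiset :: "real \<Rightarrow> bid_list \<Rightarrow> bool" where
  "bid_velocity_multiset \<gamma> B \<longleftrightarrow>
     sorted (map fst B) \<and> (\<forall>(b, v) \<in> set B. \<exists>k::int. b = \<gamma> * of_int k)"

definition velocity_class :: "int \<Rightarrow> bid_list \<Rightarrow> bid_list" where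
  "velocity_class v B = filter (\<lambda>x. snd x = v) B"

definition translate :: "bid_list \<Rightarrow> real \<Rightarrow> bid_list" where
  "translate B a = map (\<lambda>(b, v). (b + a, v)) B"

definition move :: "real \<Rightarrow> real \<Rightarrow> bid_list \<Rightarrow> bid_list" where
  "move \<gamma> p B = map (\<lambda>i. let (b, v) = B ! i; r = real (i + 1); np = real (length B) * p in
       (b + \<gamma> * of_int v * (of_bool (0 < r \<and> r \<le> np) - of_bool (np < r \<and> r \<le> real (length B))), v))
     [0..<length B]"

text \<open>
  A sorting rule assigns to every (not necessarily ordered) list of moved bidders, given in their
  previous order, a permutation of the positions that orders the bids.  Since the permutation is a
  function of that list, ties are broken deterministically.  The rule may look at the velocities and
  at the previous order, but has to be insensitive to a common shift of all bids.
\<close>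

definition sorting_rule :: "(bid_list \<Rightarrow> nat \<Rightarrow> nat) \<Rightarrow> bool" where
  "sorting_rule \<sigma> \<longleftrightarrow>
     (\<forall>B. \<sigma> B permutes {..<length B} \<and> sorted (map fst (permute_list (\<sigma> B) B))) \<and>
     (\<forall>B a. \<sigma> (translate B a) = \<sigma> B)"

definition bid_step :: "(bid_list \<Rightarrow> nat \<Rightarrow> nat) \<Rightarrow> real \<Rightarrow> real \<Rightarrow> bid_list \<Rightarrow> bid_list" where
  "bid_step \<sigma> \<gamma> p B = permute_list (\<sigma> (move \<gamma> p B)) (move \<gamma> p B)"

text \<open>The rule that keeps the previous relative order of tied bidders is an instance.\<close>

definition stable_rule :: "bid_list \<Rightarrow> nat \<Rightarrow> nat" where
  "stable_rule B i =
     (if i < length B then sort_key (\<lambda>j. fst (B ! j)) [0..<length B] ! i else i)"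

lemma insort_key_shift:
  fixes f g :: "nat \<Rightarrow> real"
  assumes "\<And>j. j \<in> insert x (set xs) \<Longrightarrow> g j = f j + a"
  shows "insort_key g x xs = insort_key f x xs"
  using assms by (induction xs) auto

lemma sort_key_shift:
  fixes f g :: "nat \<Rightarrow> real"
  assumes "\<And>j. j \<in> set xs \<Longrightarrow> g j = f j + a"
  shows "sort_key g xs = sort_key f xs"
  using assms
proof (induction xs)
  case (Cons x xs)
  then show ?case
    using insort_key_shift[of x "sort_key f xs" g f a] by simp
qed simp

lemma sorting_rule_stable_rule: "sorting_rule stable_rule"
  unfolding sorting_rule_def
proof (intro conjI allI)
  fix B :: bid_list
  let ?s = "sort_key (\<lambda>j. fst (B ! j)) [0..<length B]"
  have "bij_betw ((!) ?s) {..<length B} {..<length B}"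
    by (rule bij_betw_nth) (auto simp: atLeast0LessThan)
  then have "bij_betw (stable_rule B) {..<length B} {..<length B}"
    by (subst bij_betw_cong[where g = "(!) ?s"]) (simp_all add: stable_rule_def)
  then show "stable_rule B permutes {..<length B}"
    by (rule bij_imp_permutes) (simp add: stable_rule_def)
  have "map (stable_rule B) [0..<length B] = ?s"
    by (rule nth_equalityI) (auto simp: stable_rule_def)
  then have "map (\<lambda>j. fst (B ! j)) (map (stable_rule B) [0..<length B]) = map (\<lambda>j. fst (B ! j)) ?s"
    by (rule arg_cong)
  then have "map fst (permute_list (stable_rule B) B) = map (\<lambda>j. fst (B ! j)) ?s"
    by (simp only: permute_list_def map_map comp_def)
  then show "sorted (map fst (permute_list (stable_rule B) B))"
    by simp
next
  fix B :: bid_list and a :: real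
  have "sort_key (\<lambda>j. fst (translate B a ! j)) [0..<length B]
      = sort_key (\<lambda>j. fst (B ! j)) [0..<length B]"
    by (rule sort_key_shift[where a = a]) (auto simp: translate_def split: prod.split)
  moreover have "length (translate B a) = length B"
    by (simp add: translate_def)
  ultimately show "stable_rule (translate B a) = stable_rule B"
    by (simp add: stable_rule_def fun_eq_iff)
qed

end

theory Submission
  imports Defs
begin

text \<open>
  Give a bidder of velocity \<open>v\<close> the mass \<open>1 / v\<close>.  Each step then moves the total moment
  \<open>\<Sum> b / v\<close> by exactly \<open>\<gamma> (w - l)\<close>, so that the centre of mass drifts with the constant speed
  \<open>c = (w - l) h / n\<close>.  In a periodic increment state the slow bidders have mean speed \<open>c\<close> too,
  which forces \<open>\<bar>c\<bar> \<le> \<nu>\<^sub>m\<close>.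

  Conversely, assign to a set \<open>S\<close> of bidders its moment relative to the centre of mass plus the
  concave penalty \<open>A m(S) (M - m(S))\<close>, where \<open>m(S)\<close> is its mass and \<open>M\<close> the total mass.
  Concavity separates a minimising set from its complement by a gap, which for large \<open>A\<close> already
  existed before the step; so the minimiser consists of the \<open>j\<close> lowest bidders for some \<open>j\<close>.  If
  these are all winners they move up with speed at least \<open>\<nu>\<^sub>m \<ge> c\<close>; otherwise the others are all
  losers and move down with speed at least \<open>\<nu>\<^sub>m \<ge> - c\<close>.  In both cases the energy of the set does
  not decrease, so the minimum over all sets is nondecreasing in time.  This bounds the distances
  between the bids, and the pigeonhole principle yields the period.
\<close>

section \<open>Mass, moment and energy of a set of positions\<close>

definition mass :: "bid_list \<Rightarrow> nat set \<Rightarrow> real" where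
  "mass B S = (\<Sum>i\<in>S. 1 / of_int (snd (B ! i)))"

definition moment :: "bid_list \<Rightarrow> nat set \<Rightarrow> real" where
  "moment B S = (\<Sum>i\<in>S. fst (B ! i) / of_int (snd (B ! i)))"

text \<open>The first two terms are the sum of \<open>(b - c) / v\<close> over \<open>S\<close>,
  with \<open>c\<close> the centre of mass. For nonzero total mass the energy is invariant under a
  common translation and vanishes on the empty and on the full set.\<close>

definition energy :: "real \<Rightarrow> bid_list \<Rightarrow> nat set \<Rightarrow> real" where
  "energy A B S = moment B S - mass B S / mass B {..<length B} * moment B {..<length B}
     + A * mass B S * (mass B {..<length B} - mass B S)"

section \<open>One step: moving, then reordering\<close>

lemma length_move [simp]: "length (move \<gamma> p B) = length B"
  by (simp add: move_def)

text \<open>Position \<open>i\<close> has rank \<open>i + 1\<close>, which is at most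
  \<open>np = W\<close> exactly if \<open>i < W\<close>; every other position of the list
  loses.\<close>

lemma nth_move:
  assumes "real (length B) * p = real W" "i < length B"
  shows "move \<gamma> p B ! i =
    (fst (B ! i) + \<gamma> * of_int (snd (B ! i)) * (if i < W then 1 else -1), snd (B ! i))"
  using assms by (auto simp: move_def Let_def split: prod.split)

lemma length_bid_step [simp]: "length (bid_step \<sigma> \<gamma> p B) = length B"
  by (simp add: bid_step_def)

lemma mset_bid_step:
  assumes "sorting_rule \<sigma>"
  shows "mset (bid_step \<sigma> \<gamma> p B) = mset (move \<gamma> p B)"
  using assms unfolding bid_step_def sorting_rule_def
  by (metis length_move mset_permute_list)

lemma sorted_bid_step:
  assumes "sorting_rule \<sigma>"
  shows "sorted (map fst (bid_step \<sigma> \<gamma> p B))"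
  using assms by (simp add: bid_step_def sorting_rule_def)

lemma length_translate [simp]: "length (translate B a) = length B"
  by (simp add: translate_def)

lemma nth_translate:
  "i < length B \<Longrightarrow> translate B a ! i = (fst (B ! i) + a, snd (B ! i))"
  by (simp add: translate_def split: prod.split)

lemma sum_list_mset_cong:
  fixes f :: "'a \<Rightarrow> real"
  assumes "mset xs = mset ys"
  shows "(\<Sum>x\<leftarrow>xs. f x) = (\<Sum>x\<leftarrow>ys. f x)"
  using assms by (metis mset_map sum_mset_sum_list)

text \<open>Sorting only permutes the moved bidders, so a sum over all positions can be evaluated
  before sorting. The balances of mass, moment and velocity classes arise from this by the choice of
  \<open>f\<close>.\<close>

lemma sum_nth_bid_step:
  fixes f :: "real \<times> int \<Rightarrow> real"
  assumes "sorting_rule \<sigma>"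
  shows "(\<Sum>i<length B. f (bid_step \<sigma> \<gamma> p B ! i)) = (\<Sum>i<length B. f (move \<gamma> p B ! i))"
  using sum_list_mset_cong[OF mset_bid_step[OF assms], of f \<gamma> p B]
  by (simp add: sum_list_sum_nth atLeast0LessThan)

lemma winner_balance:
  "(\<Sum>i<j. if i < W then 1 else -1) = 2 * real (min j W) - real j"
  by (induction j) (auto simp: min_def)

text \<open>The weight \<open>1 / v\<close> cancels the speed: a winner adds \<gamma>, a loser
  subtracts \<gamma>, and the first \<open>j\<close> positions hold \<open>min j W\<close>
  winners.\<close>

lemma moment_move_prefix:
  assumes "real (length B) * p = real W" "\<forall>x\<in>set B. 0 < snd x" "j \<le> length B"
  shows "moment (move \<gamma> p B) {..<j} = moment B {..<j} + \<gamma> * (2 * real (min j W) - real j)"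
proof -
  have "moment (move \<gamma> p B) {..<j}
      = (\<Sum>i<j. fst (B ! i) / of_int (snd (B ! i)) + \<gamma> * (if i < W then 1 else -1))"
    unfolding moment_def
  proof (rule sum.cong[OF refl])
    fix i assume "i \<in> {..<j}"
    then have "i < length B" using assms(3) by simp
    moreover from this have "0 < snd (B ! i)" using assms(2) by simp
    ultimately show "fst (move \<gamma> p B ! i) / of_int (snd (move \<gamma> p B ! i))
        = fst (B ! i) / of_int (snd (B ! i)) + \<gamma> * (if i < W then 1 else -1)"
      by (simp add: nth_move[OF assms(1)] field_simps)
  qed
  then show ?thesis
    by (simp only: sum.distrib moment_def sum_distrib_left[symmetric] winner_balance)
qed

lemma mass_move:
  assumes "real (length B) * p = real W" "S \<subseteq> {..<length B}"
  shows "mass (move \<gamma> p B) S = mass B S"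
  unfolding mass_def using assms by (intro sum.cong) (auto simp: nth_move)

lemma mass_permute_list:
  assumes "\<pi> permutes {..<length B}" "S \<subseteq> {..<length B}"
  shows "mass (permute_list \<pi> B) S = mass B (\<pi> ` S)"
proof -
  have "inj_on \<pi> S" using assms(1) by (meson inj_on_subset permutes_inj subset_UNIV)
  then show ?thesis
    using assms by (auto simp: mass_def sum.reindex permute_list_nth intro!: sum.cong)
qed

lemma moment_permute_list:
  assumes "\<pi> permutes {..<length B}" "S \<subseteq> {..<length B}"
  shows "moment (permute_list \<pi> B) S = moment B (\<pi> ` S)"
proof -
  have "inj_on \<pi> S" using assms(1) by (meson inj_on_subset permutes_inj subset_UNIV)
  then show ?thesis
    using assms by (auto simp: moment_def sum.reindex permute_list_nth intro!: sum.cong)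
qed

text \<open>Permuting the list relabels sets of positions; the totals survive because the full set
  of positions is its own image.\<close>

lemma energy_permute_list:
  assumes "\<pi> permutes {..<length B}" "S \<subseteq> {..<length B}"
  shows "energy A (permute_list \<pi> B) S = energy A B (\<pi> ` S)"
  using assms permutes_image[OF assms(1)]
  by (simp add: energy_def mass_permute_list moment_permute_list)

section \<open>Shape of the energy minimisers\<close>

text \<open>Test minimality against removing \<open>i\<close> and against adding \<open>k\<close>.
  With \<open>x\<close> the mass of \<open>S\<close>, the first puts the bid of \<open>i\<close>,
  relative to \<open>c\<close>, below \<open>A * (2 * x - M)\<close> by at least
  \<open>A * m i\<close>; the second puts that of \<open>k\<close> above it by at least
  \<open>A * m k\<close>. These margins come from the concavity of the penalty.\<close>

lemma energy_minimiser_gap: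
  assumes pos: "\<forall>x\<in>set B. 0 < snd x"
    and S: "S \<subseteq> {..<length B}"
    and min: "\<And>R. R \<subseteq> {..<length B} \<Longrightarrow> energy A B S \<le> energy A B R"
    and i: "i \<in> S" and k: "k < length B" "k \<notin> S"
  shows "A * (1 / of_int (snd (B ! i)) + 1 / of_int (snd (B ! k))) \<le> fst (B ! k) - fst (B ! i)"
proof -
  define M where "M = mass B {..<length B}"
  define c where "c = moment B {..<length B} / M"
  define x where "x = mass B S"
  define m where "m j = 1 / real_of_int (snd (B ! j))" for j
  have fin: "finite S" using S finite_subset by blast
  have iB: "i < length B" using S i by auto
  have m_pos: "0 < m i" "0 < m k"
    using pos iB k by (simp_all add: m_def)
  have E: "energy A B R = moment B R - mass B R * c + A * mass B R * (M - mass B R)" for R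
    by (simp add: energy_def M_def c_def)
  have mass_del: "mass B (S - {i}) = x - m i" and mom_del: "moment B (S - {i}) = moment B S - m i * fst (B ! i)"
    and mass_ins: "mass B (insert k S) = x + m k" and mom_ins: "moment B (insert k S) = moment B S + m k * fst (B ! k)"
    using fin i k by (simp_all add: mass_def moment_def x_def m_def sum_diff1)
  have "energy A B S \<le> energy A B (S - {i})" using S by (intro min) auto
  then have "m i * (fst (B ! i) - c) \<le> m i * (A * (2 * x - M - m i))"
    unfolding E mass_del mom_del x_def[symmetric] by (simp add: algebra_simps)
  then have "fst (B ! i) - c \<le> A * (2 * x - M - m i)" using m_pos by simp
  moreover have "energy A B S \<le> energy A B (insert k S)" using S k by (intro min) auto
  then have "m k * (A * (2 * x - M + m k)) \<le> m k * (fst (B ! k) - c)"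
    unfolding E mass_ins mom_ins x_def[symmetric] by (simp add: algebra_simps)
  then have "A * (2 * x - M + m k) \<le> fst (B ! k) - c" using m_pos by simp
  ultimately show ?thesis by (simp add: m_def[symmetric] algebra_simps)
qed

text \<open>The prefix ends at the least position outside \<open>S\<close>, which is at most
  \<open>n\<close> because \<open>n\<close> itself lies outside.\<close>

lemma downward_closed_is_prefix:
  fixes S :: "nat set"
  assumes "S \<subseteq> {..<n}" and "\<And>i k. i \<in> S \<Longrightarrow> k < n \<Longrightarrow> k \<notin> S \<Longrightarrow> i < k"
  obtains j where "j \<le> n" "S = {..<j}"
proof
  define j where "j = (LEAST k. k \<notin> S)"
  have "n \<notin> S" using assms(1) by auto
  then have j: "j \<notin> S" "j \<le> n" unfolding j_def by (rule LeastI[of "\<lambda>k. k \<notin> S"], rule Least_le)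
  show "j \<le> n" by fact
  show "S = {..<j}"
  proof
    show "{..<j} \<subseteq> S" using not_less_Least unfolding j_def by blast
    show "S \<subseteq> {..<j}"
    proof
      fix i assume "i \<in> S"
      then show "i \<in> {..<j}"
        using assms j by (cases "j < n") auto
    qed
  qed
qed

section \<open>Monotonicity of the minimal energy\<close>

text \<open>Each mass \<open>1 / v\<close> is at most \<open>1 / \<nu>\<close>. So a drift of speed
  at most \<nu> accounts for at most one unit of moment per bidder, which is what one win or loss
  contributes.\<close>

lemma mass_bounds:
  assumes "0 < \<nu>" "\<forall>x\<in>set B. \<nu> \<le> snd x" "S \<subseteq> {..<length B}"
  shows "0 \<le> mass B S" "of_int \<nu> * mass B S \<le> real (card S)"
proof -
  have v: "\<nu> \<le> snd (B ! i)" if "i \<in> S" for i using that assms by auto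
  show "0 \<le> mass B S"
    unfolding mass_def using assms(1) by (intro sum_nonneg) (force dest: v)
  have "of_int \<nu> * mass B S = (\<Sum>i\<in>S. of_int \<nu> / of_int (snd (B ! i)))"
    by (simp add: mass_def sum_distrib_left)
  also have "\<dots> \<le> (\<Sum>i\<in>S. 1)"
    using assms(1) by (intro sum_mono) (force dest: v simp: divide_le_eq)
  finally show "of_int \<nu> * mass B S \<le> real (card S)" by simp
qed

lemma mass_pos:
  assumes "\<forall>x\<in>set B. 0 < snd x" "B \<noteq> []"
  shows "0 < mass B {..<length B}"
  unfolding mass_def using assms by (intro sum_pos) auto

lemma mass_prefix_compl:
  assumes "j \<le> length B"
  shows "mass B {..<length B} = mass B {..<j} + mass B {j..<length B}"
  using assms sum.atLeastLessThan_concat[of 0 j "length B" "\<lambda>i. 1 / real_of_int (snd (B ! i))"]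
  by (simp add: mass_def lessThan_atLeast0)

text \<open>The move keeps masses and hence the penalty, so only the moment relative to the centre
  of mass counts: in units of \<gamma>, the gain \<open>2 * min j W - j\<close> of the prefix has to
  cover its share \<open>x * s\<close> of the total drift.\<close>

lemma energy_move_prefix:
  assumes "0 < \<gamma>" and W: "real (length B) * p = real W" "W \<le> length B"
    and "0 < \<nu>" and vel: "\<forall>x\<in>set B. \<nu> \<le> snd x" and "B \<noteq> []"
    and drift: "\<bar>2 * real W - real (length B)\<bar> \<le> of_int \<nu> * mass B {..<length B}"
    and j: "j \<le> length B"
  shows "energy A B {..<j} \<le> energy A (move \<gamma> p B) {..<j}"
proof -
  have pos: "\<forall>x\<in>set B. 0 < snd x" using \<open>0 < \<nu>\<close> vel by force
  define M where "M = mass B {..<length B}"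
  define x where "x = mass B {..<j}"
  define y where "y = mass B {j..<length B}"
  define q where "q = 2 * real W - real (length B)"
  have M: "M = x + y" "0 < M"
    using mass_prefix_compl[OF j] mass_pos[OF pos \<open>B \<noteq> []\<close>] by (simp_all add: M_def x_def y_def)
  have x: "0 \<le> x" "of_int \<nu> * x \<le> real j"
    using mass_bounds[OF \<open>0 < \<nu>\<close> vel, of "{..<j}"] j by (auto simp: x_def)
  have "{j..<length B} \<subseteq> {..<length B}" by auto
  from mass_bounds[OF \<open>0 < \<nu>\<close> vel this]
  have y: "0 \<le> y" "of_int \<nu> * y \<le> real (length B) - real j"
    using j by (simp_all add: y_def of_nat_diff)
  \<comment> \<open>The displacement of the centre of mass in one step, in units of
    \<gamma>.\<close>
  define s where "s = q / M"
  have s: "q = s * M" using M by (simp add: s_def)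
  have "\<bar>s\<bar> * M \<le> of_int \<nu> * M"
    using drift M(2) by (simp add: q_def[symmetric] M_def[symmetric] s abs_mult)
  then have s_le: "\<bar>s\<bar> \<le> of_int \<nu>" using M(2) by simp
  have "x * s \<le> 2 * real (min j W) - real j"
  proof (cases "j \<le> W")
    case True
    have "x * s \<le> x * of_int \<nu>" using s_le x(1) by (intro mult_left_mono) auto
    then show ?thesis using x(2) True by (simp add: mult.commute)
  next
    \<comment> \<open>All positions from \<open>j\<close> on are losers now, so the estimate is made
      on the complement: \<open>2 * W - j\<close> equals \<open>q\<close> plus the number of these
      positions, and \<open>q = x * s + y * s\<close>.\<close>
    case False
    have "y * (- s) \<le> y * of_int \<nu>" using s_le y(1) by (intro mult_left_mono) auto
    then have "- (y * s) \<le> real (length B) - real j" using y(2) by (simp add: mult.commute)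
    moreover have "q = x * s + y * s" using s M(1) by (simp add: algebra_simps)
    ultimately show ?thesis using False by (simp add: q_def)
  qed
  then have "\<gamma> * (x * s) \<le> \<gamma> * (2 * real (min j W) - real j)"
    using \<open>0 < \<gamma>\<close> by simp
  moreover have "mass (move \<gamma> p B) {..<j} = x" "mass (move \<gamma> p B) {..<length B} = M"
    using mass_move[OF W(1)] j by (auto simp: x_def M_def)
  moreover have "x / M * (\<gamma> * q) = \<gamma> * (x * s)"
    by (simp add: s_def)
  ultimately show ?thesis
    using W(2)
    by (simp add: energy_def moment_move_prefix[OF W(1) pos] j x_def[symmetric] M_def[symmetric]
        distrib_left min_absorb2 q_def[symmetric])
qed

text \<open>Sorting merely relabels sets, so it suffices to bound the minimum over the moved, still
  unsorted list. Its minimiser is a prefix in the old order, and on prefixes the energy does not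
  drop.\<close>

lemma energy_bid_step_lower_bound:
  assumes "sorting_rule \<sigma>" and "0 < \<gamma>"
    and W: "real (length B) * p = real W" "W \<le> length B"
    and sorted: "sorted (map fst B)"
    and "0 < \<nu>" and vel: "\<forall>x\<in>set B. \<nu> \<le> snd x" and "B \<noteq> []"
    and A: "\<forall>x\<in>set B. \<gamma> * (of_int (snd x))\<^sup>2 < A"
    and drift: "\<bar>2 * real W - real (length B)\<bar> \<le> of_int \<nu> * mass B {..<length B}"
    and bound: "\<And>S. S \<subseteq> {..<length B} \<Longrightarrow> C \<le> energy A B S"
    and S: "S \<subseteq> {..<length B}"
  shows "C \<le> energy A (bid_step \<sigma> \<gamma> p B) S"
proof -
  let ?B' = "move \<gamma> p B"
  let ?I = "{..<length B}"
  have pos: "\<forall>x\<in>set B. 0 < snd x" using \<open>0 < \<nu>\<close> vel by force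
  have pos': "\<forall>x\<in>set ?B'. 0 < snd x"
    using pos by (simp add: all_set_conv_all_nth nth_move[OF W(1)])
  obtain R where R: "R \<in> Pow ?I" "\<And>Q. Q \<in> Pow ?I \<Longrightarrow> energy A ?B' R \<le> energy A ?B' Q"
    by (metis (no_types, lifting) Pow_not_empty arg_min_if_finite(1) arg_min_least finite_Pow_iff finite_lessThan)
  \<comment> \<open>After the move the bid of \<open>k\<close> exceeds that of \<open>i\<close> by
    at least \<open>A / u + A / v\<close>. The move can have widened the difference by at most
    \<open>\<gamma> * u + \<gamma> * v\<close>, which is smaller by the choice of \<open>A\<close>;
    hence the old bids were already in this order.\<close>
  have "i < k" if "i \<in> R" "k < length B" "k \<notin> R" for i k
  proof (rule ccontr)
    assume "\<not> i < k"
    have iB: "i < length B" using that R(1) by auto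
    define u v where "u = real_of_int (snd (B ! i))" and "v = real_of_int (snd (B ! k))"
    have uv: "0 < u" "0 < v" "\<gamma> * u < A / u" "\<gamma> * v < A / v"
      using pos A iB that by (auto simp: u_def v_def power2_eq_square less_divide_eq algebra_simps)
    have "A * (1 / of_int (snd (?B' ! i)) + 1 / of_int (snd (?B' ! k))) \<le> fst (?B' ! k) - fst (?B' ! i)"
      using R that by (intro energy_minimiser_gap[OF pos', of R]) auto
    then have "A / u + A / v \<le> fst (?B' ! k) - fst (?B' ! i)"
      using iB that by (simp add: nth_move[OF W(1)] u_def v_def distrib_left)
    moreover have "fst (?B' ! k) \<le> fst (B ! k) + \<gamma> * v" "fst (B ! i) - \<gamma> * u \<le> fst (?B' ! i)"
      using iB that uv \<open>0 < \<gamma>\<close> by (auto simp: nth_move[OF W(1)] u_def v_def)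
    ultimately have "fst (B ! i) < fst (B ! k)" using uv by linarith
    moreover have "fst (B ! k) \<le> fst (B ! i)"
      using sorted_nth_mono[OF sorted, of k i] \<open>\<not> i < k\<close> iB that by simp
    ultimately show False by simp
  qed
  then obtain j where j: "j \<le> length B" "R = {..<j}"
    using downward_closed_is_prefix[of R "length B"] R(1) by blast
  have \<sigma>: "\<sigma> ?B' permutes {..<length ?B'}" using \<open>sorting_rule \<sigma>\<close> unfolding sorting_rule_def by blast
  have "C \<le> energy A B R" using R(1) by (intro bound) auto
  also have "\<dots> \<le> energy A ?B' R"
    using energy_move_prefix[OF \<open>0 < \<gamma>\<close> W \<open>0 < \<nu>\<close> vel \<open>B \<noteq> []\<close> drift j(1)] j(2) by simp
  also have "\<dots> \<le> energy A ?B' (\<sigma> ?B' ` S)"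
    using S permutes_image[OF \<sigma>] by (intro R(2)) auto
  also have "\<dots> = energy A (bid_step \<sigma> \<gamma> p B) S"
    using S by (simp add: bid_step_def energy_permute_list[OF \<sigma>])
  finally show ?thesis .
qed

section \<open>From bounded energy to bounded distances\<close>

text \<open>A singleton and its complement have opposite relative moments and the same penalty, at
  most \<open>A * M\<^sup>2\<close>. Bounding both energies below by \<open>C\<close> therefore
  confines each bid to a neighbourhood of the centre of mass; the factor 2 is the triangle
  inequality through the centre.\<close>

lemma bid_distance_bound:
  assumes pos: "\<forall>x\<in>set B. 0 < snd x" and vel: "\<forall>x\<in>set B. snd x \<le> \<nu>" and "0 \<le> A"
    and bound: "\<And>S. S \<subseteq> {..<length B} \<Longrightarrow> C \<le> energy A B S"
    and i: "i < length B" and k: "k < length B"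
  shows "\<bar>fst (B ! i) - fst (B ! k)\<bar> \<le> 2 * of_int \<nu> * (A * (mass B {..<length B})\<^sup>2 - C)"
proof -
  define M where "M = mass B {..<length B}"
  define c where "c = moment B {..<length B} / M"
  define D where "D = A * M\<^sup>2 - C"
  have "B \<noteq> []" using i by auto
  then have M: "0 < M" using mass_pos[OF pos] by (simp add: M_def)
  have c: "moment B {..<length B} = M * c" using M by (simp add: c_def)
  have E: "energy A B R = moment B R - mass B R * c + A * (mass B R * (M - mass B R))" for R
    by (simp add: energy_def M_def c_def)
  have "\<bar>fst (B ! j) - c\<bar> \<le> of_int \<nu> * D" if j: "j < length B" for j
  proof -
    define v where "v = real_of_int (snd (B ! j))"
    define m where "m = 1 / v"
    have v: "0 < v" "v \<le> of_int \<nu>" using pos vel j by (auto simp: v_def)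
    have single: "mass B {j} = m" "moment B {j} = m * fst (B ! j)"
      by (simp_all add: mass_def moment_def m_def v_def)
    have rest: "mass B ({..<length B} - {j}) = M - m" "moment B ({..<length B} - {j}) = M * c - m * fst (B ! j)"
      using j c by (simp_all add: mass_def moment_def m_def v_def M_def sum_diff1)
    have "0 \<le> mass B ({..<length B} - {j})"
      using pos unfolding mass_def by (intro sum_nonneg) (auto simp: less_imp_le)
    then have m: "0 < m" "m \<le> M" using v by (simp_all add: rest m_def)
    then have "m * (M - m) \<le> M * M" by (intro mult_mono) auto
    then have pen: "A * (m * (M - m)) \<le> A * M\<^sup>2"
      using \<open>0 \<le> A\<close> by (simp add: power2_eq_square mult_left_mono)
    have "C \<le> energy A B {j}" using j by (intro bound) auto
    then have lo: "C \<le> m * (fst (B ! j) - c) + A * (m * (M - m))"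
      by (simp add: E single algebra_simps)
    have "C \<le> energy A B ({..<length B} - {j})" by (intro bound) auto
    then have hi: "C \<le> - (m * (fst (B ! j) - c)) + A * (m * (M - m))"
      by (simp add: E rest algebra_simps)
    have "\<bar>m * (fst (B ! j) - c)\<bar> \<le> D" using lo hi pen by (simp add: D_def)
    moreover have "v * \<bar>m * (fst (B ! j) - c)\<bar> = \<bar>fst (B ! j) - c\<bar>"
      using v by (simp add: m_def abs_mult)
    ultimately have "\<bar>fst (B ! j) - c\<bar> \<le> v * D"
      using v by (metis mult_left_mono less_imp_le)
    moreover have "0 \<le> D" using lo hi pen by (simp add: D_def)
    then have "v * D \<le> of_int \<nu> * D" using v by (intro mult_right_mono)
    ultimately show ?thesis by simp
  qed
  from this[OF i] this[OF k] show ?thesis by (simp add: D_def M_def)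
qed

section \<open>Totals along the motion\<close>

lemma mass_bid_step:
  assumes "sorting_rule \<sigma>" "real (length B) * p = real W"
  shows "mass (bid_step \<sigma> \<gamma> p B) {..<length B} = mass B {..<length B}"
  using sum_nth_bid_step[OF assms(1), where f = "\<lambda>x. 1 / of_int (snd x)"] mass_move[OF assms(2), of "{..<length B}"]
  by (simp add: mass_def)

lemma moment_bid_step:
  assumes "sorting_rule \<sigma>" "real (length B) * p = real W" "W \<le> length B" "\<forall>x\<in>set B. 0 < snd x"
  shows "moment (bid_step \<sigma> \<gamma> p B) {..<length B}
    = moment B {..<length B} + \<gamma> * (2 * real W - real (length B))"
  using sum_nth_bid_step[OF assms(1), where f = "\<lambda>x. fst x / of_int (snd x)"]
    moment_move_prefix[OF assms(2,4) order_refl] assms(3)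
  by (simp add: moment_def min_absorb2)

text \<open>Written with an indicator over positions so that \<open>sum_nth_bid_step\<close> applies
  directly.\<close>

definition class_sum :: "int \<Rightarrow> bid_list \<Rightarrow> real" where
  "class_sum \<nu> B = (\<Sum>i<length B. if snd (B ! i) = \<nu> then fst (B ! i) else 0)"

lemma length_velocity_class:
  "real (length (velocity_class \<nu> B)) = (\<Sum>i<length B. if snd (B ! i) = \<nu> then 1 else 0)"
  by (simp add: velocity_class_def length_filter_conv_card sum.If_cases Int_def lessThan_def)

text \<open>Every member of the class moves by exactly \<open>\<gamma> * \<nu>\<close>, up or
  down.\<close>

lemma class_sum_bid_step:
  assumes "sorting_rule \<sigma>" "real (length B) * p = real W" "0 < \<gamma>" "0 < \<nu>"
  shows "\<bar>class_sum \<nu> (bid_step \<sigma> \<gamma> p B) - class_sum \<nu> B\<bar>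
    \<le> \<gamma> * of_int \<nu> * real (length (velocity_class \<nu> B))"
proof -
  have "class_sum \<nu> (bid_step \<sigma> \<gamma> p B) - class_sum \<nu> B
      = (\<Sum>i<length B. (if snd (move \<gamma> p B ! i) = \<nu> then fst (move \<gamma> p B ! i) else 0)
          - (if snd (B ! i) = \<nu> then fst (B ! i) else 0))"
    using sum_nth_bid_step[OF assms(1), where f = "\<lambda>x. if snd x = \<nu> then fst x else 0"]
    by (simp add: class_sum_def sum_subtractf)
  also have "\<bar>\<dots>\<bar> \<le> (\<Sum>i<length B. \<gamma> * of_int \<nu> * (if snd (B ! i) = \<nu> then 1 else 0))"
    using assms(3,4) by (intro order_trans[OF sum_abs] sum_mono) (auto simp: nth_move[OF assms(2)] abs_mult)
  also have "\<dots> = \<gamma> * of_int \<nu> * real (length (velocity_class \<nu> B))"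
    by (simp only: length_velocity_class sum_distrib_left)
  finally show ?thesis .
qed

lemma class_sum_translate:
  "class_sum \<nu> (translate B a) = class_sum \<nu> B + real (length (velocity_class \<nu> B)) * a"
proof -
  have "class_sum \<nu> (translate B a)
      = (\<Sum>i<length B. (if snd (B ! i) = \<nu> then fst (B ! i) else 0) + (if snd (B ! i) = \<nu> then 1 else 0) * a)"
    unfolding class_sum_def by (intro sum.cong) (auto simp: nth_translate)
  then show ?thesis
    by (simp only: class_sum_def length_velocity_class sum_distrib_right sum.distrib)
qed

lemma moment_translate:
  "moment (translate B a) {..<length B} = moment B {..<length B} + mass B {..<length B} * a"
  by (simp add: moment_def mass_def nth_translate add_divide_distrib sum.distrib sum_distrib_right)

lemma length_velocity_class_bid_step:
  assumes "sorting_rule \<sigma>" "real (length B) * p = real W"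
  shows "length (velocity_class \<nu> (bid_step \<sigma> \<gamma> p B)) = length (velocity_class \<nu> B)"
proof -
  have "real (length (velocity_class \<nu> (bid_step \<sigma> \<gamma> p B))) = real (length (velocity_class \<nu> B))"
    using sum_nth_bid_step[OF assms(1), where f = "\<lambda>x. if snd x = \<nu> then 1 else 0"]
    by (simp add: length_velocity_class) (simp add: nth_move[OF assms(2)])
  then show ?thesis by simp
qed

text \<open>Identifies the total mass as the denominator of \<open>h\<close>.\<close>

lemma mass_two_velocities:
  assumes "snd ` set B \<subseteq> {\<mu>, \<nu>}" "\<mu> \<noteq> \<nu>"
  shows "mass B {..<length B} = real (length (velocity_class \<mu> B)) / of_int \<mu>
    + real (length (velocity_class \<nu> B)) / of_int \<nu>"
proof -
  have "mass B {..<length B} = (\<Sum>i<length B. (if snd (B ! i) = \<mu> then 1 else 0) / of_int \<mu>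
      + (if snd (B ! i) = \<nu> then 1 else 0) / of_int \<nu>)"
    unfolding mass_def
  proof (rule sum.cong[OF refl])
    fix i assume "i \<in> {..<length B}"
    then have "snd (B ! i) \<in> {\<mu>, \<nu>}" using assms(1) nth_mem by blast
    then show "1 / real_of_int (snd (B ! i)) = (if snd (B ! i) = \<mu> then 1 else 0) / of_int \<mu>
      + (if snd (B ! i) = \<nu> then 1 else 0) / of_int \<nu>"
      using assms(2) by auto
  qed
  then show ?thesis
    by (simp only: length_velocity_class sum.distrib sum_divide_distrib)
qed

lemma snd_set_bid_step:
  assumes "sorting_rule \<sigma>" "real (length B) * p = real W"
  shows "snd ` set (bid_step \<sigma> \<gamma> p B) = snd ` set B"
proof -
  have "map snd (move \<gamma> p B) = map snd B"
    by (rule nth_equalityI) (auto simp: nth_move[OF assms(2)])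
  then have "snd ` set (move \<gamma> p B) = snd ` set B" by (metis list.set_map)
  moreover have "set (bid_step \<sigma> \<gamma> p B) = set (move \<gamma> p B)"
    using mset_bid_step[OF assms(1)] by (rule mset_eq_setD)
  ultimately show ?thesis by simp
qed

text \<open>Velocities are integers, so a move shifts each bid by a whole number of grid
  steps.\<close>

lemma bid_velocity_multiset_bid_step:
  assumes "sorting_rule \<sigma>" "real (length B) * p = real W" "bid_velocity_multiset \<gamma> B"
  shows "bid_velocity_multiset \<gamma> (bid_step \<sigma> \<gamma> p B)"
proof -
  have "\<exists>k::int. fst x = \<gamma> * of_int k" if x: "x \<in> set (move \<gamma> p B)" for x
  proof -
    obtain i where i: "i < length B" "x = move \<gamma> p B ! i" using x by (auto simp: in_set_conv_nth)
    then have "B ! i \<in> set B" by simp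
    then obtain k :: int where "fst (B ! i) = \<gamma> * of_int k"
      using assms(3) by (force simp: bid_velocity_multiset_def)
    then have "fst x = \<gamma> * of_int (k + snd (B ! i) * (if i < W then 1 else -1))"
      using i by (simp add: nth_move[OF assms(2)] distrib_left)
    then show ?thesis by blast
  qed
  moreover have "set (bid_step \<sigma> \<gamma> p B) = set (move \<gamma> p B)"
    using mset_bid_step[OF assms(1)] by (rule mset_eq_setD)
  ultimately show ?thesis
    using sorted_bid_step[OF assms(1)] unfolding bid_velocity_multiset_def by fastforce
qed

section \<open>Periodicity by the pigeonhole principle\<close>

text \<open>Translate every state so that its first bid is 0. The bids are then grid points in a
  bounded interval, so only finitely many normalised states exist and two of them coincide.\<close>

lemma periodic_if_bounded:
  fixes F :: "nat \<Rightarrow> bid_list"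
  assumes "0 < \<gamma>" "0 < n" and len: "\<And>t. length (F t) = n"
    and grid: "\<And>t x. x \<in> set (F t) \<Longrightarrow> \<exists>k::int. fst x = \<gamma> * of_int k"
    and "finite V" and vel: "\<And>t. snd ` set (F t) \<subseteq> V"
    and bound: "\<And>t i k. i < n \<Longrightarrow> k < n \<Longrightarrow> \<bar>fst (F t ! i) - fst (F t ! k)\<bar> \<le> D"
  shows "\<exists>k\<^sub>0 K (N::int). 1 \<le> K \<and> F (k\<^sub>0 + K) = translate (F k\<^sub>0) (\<gamma> * of_int N)"
proof -
  define G where "G t = translate (F t) (- fst (F t ! 0))" for t
  define Z where "Z = \<lceil>D / \<gamma>\<rceil>"
  define X where "X = (\<lambda>k::int. \<gamma> * of_int k) ` {-Z..Z}"
  have "set (G t) \<subseteq> X \<times> V" for t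
  proof
    fix x assume "x \<in> set (G t)"
    then obtain i where i: "i < n" "x = G t ! i" by (auto simp: in_set_conv_nth G_def len)
    then have x: "x = (fst (F t ! i) - fst (F t ! 0), snd (F t ! i))"
      by (simp add: G_def nth_translate len)
    obtain a b :: int where ab: "fst (F t ! i) = \<gamma> * of_int a" "fst (F t ! 0) = \<gamma> * of_int b"
      using grid i \<open>0 < n\<close> len by (metis nth_mem)
    have "\<bar>\<gamma> * of_int (a - b)\<bar> \<le> D"
      using bound[OF i(1) \<open>0 < n\<close>, of t] by (simp add: ab right_diff_distrib)
    then have "\<bar>of_int (a - b)\<bar> \<le> D / \<gamma>"
      using \<open>0 < \<gamma>\<close> by (simp add: abs_mult le_divide_eq mult.commute)
    then have "of_int \<bar>a - b\<bar> \<le> D / \<gamma>" by simp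
    then have "\<bar>a - b\<bar> \<le> Z" unfolding Z_def by linarith
    then have "fst x \<in> X"
      unfolding X_def x ab by (intro image_eqI[of _ _ "a - b"]) (auto simp: right_diff_distrib)
    moreover have "F t ! i \<in> set (F t)" using i(1) len by simp
    then have "snd x \<in> V" using vel[of t] by (auto simp: x)
    ultimately show "x \<in> X \<times> V" by (cases x) simp
  qed
  then have "range G \<subseteq> {xs. set xs \<subseteq> X \<times> V \<and> length xs = n}" by (auto simp: G_def len)
  moreover have "finite {xs. set xs \<subseteq> X \<times> V \<and> length xs = n}"
    using \<open>finite V\<close> by (intro finite_lists_length_eq) (simp add: X_def)
  ultimately have "\<not> inj G" using finite_subset finite_imageD infinite_UNIV_nat by blast
  then obtain s t where st: "s < t" "G s = G t"
    unfolding inj_def by (metis nat_neq_iff)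
  obtain a b :: int where ab: "fst (F s ! 0) = \<gamma> * of_int a" "fst (F t ! 0) = \<gamma> * of_int b"
    using grid \<open>0 < n\<close> len by (metis nth_mem)
  \<comment> \<open>Undoing the normalisation leaves the difference of the two first bids, an
    integer multiple of \<gamma>.\<close>
  have "F t = translate (F s) (\<gamma> * of_int (b - a))"
  proof (rule nth_equalityI)
    fix i assume "i < length (F t)"
    then have i: "i < n" by (simp add: len)
    have "G s ! i = G t ! i" using st by simp
    then show "F t ! i = translate (F s) (\<gamma> * of_int (b - a)) ! i"
      using i by (auto simp: G_def nth_translate len ab prod_eq_iff algebra_simps)
  qed (simp add: len)
  then show ?thesis using st(1)
    by (intro exI[of _ s] exI[of _ "t - s"] exI[of _ "b - a"]) simp
qed

section \<open>The equivalence\<close>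

theorem proposition6p4:
  fixes \<gamma> p w l h :: real
    and \<nu>\<^sub>m \<nu>\<^sub>p :: int
    and n n\<^sub>m n\<^sub>p :: nat
    and B :: bid_list
    and \<sigma> :: "bid_list \<Rightarrow> nat \<Rightarrow> nat"
  assumes "0 < \<gamma>" and "\<exists>m::nat. \<gamma> = 1 / real m"
    and "0 \<le> p" and "p \<le> 1"
    and "0 < \<nu>\<^sub>m" and "\<nu>\<^sub>m < \<nu>\<^sub>p"
    and "bid_velocity_multiset \<gamma> B"
    and "snd ` set B \<subseteq> {\<nu>\<^sub>m, \<nu>\<^sub>p}"
    and "n = length B"
    and "n\<^sub>m = length (velocity_class \<nu>\<^sub>m B)" and "1 \<le> n\<^sub>m"
    and "n\<^sub>p = length (velocity_class \<nu>\<^sub>p B)" and "1 \<le> n\<^sub>p"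
    and "real n * p \<in> \<nat>"
    and "w = real n * p" and "l = real n * (1 - p)"
    and "h = real n / (real n\<^sub>m / of_int \<nu>\<^sub>m + real n\<^sub>p / of_int \<nu>\<^sub>p)"
    and "sorting_rule \<sigma>"
  shows "(\<exists>(k\<^sub>0::nat) (K::nat) (N::int). 1 \<le> K \<and>
            (bid_step \<sigma> \<gamma> p ^^ (k\<^sub>0 + K)) B
              = translate ((bid_step \<sigma> \<gamma> p ^^ k\<^sub>0) B) (\<gamma> * of_int N))
         \<longleftrightarrow> \<bar>w - l\<bar> / real n * h \<le> of_int \<nu>\<^sub>m"
proof -
  define F where "F t = (bid_step \<sigma> \<gamma> p ^^ t) B" for t
  define M where "M = mass B {..<n}"
  obtain W where W: "real n * p = real W" using assms(14) by (auto elim: Nats_cases)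
  have "real n * p \<le> real n * 1" using assms(4) by (intro mult_left_mono) auto
  then have Wn: "W \<le> n" using W by simp
  define q where "q = 2 * real W - real n"
  have q: "w - l = q" using assms(15,16) W by (simp add: q_def algebra_simps)
  have "B \<noteq> []" using assms(10,11) by (auto simp: velocity_class_def)
  then have n: "0 < n" using assms(9) by simp
  have vel_init: "\<forall>x\<in>set B. 0 < snd x" using assms(5,6,8) by force
  have M: "0 < M" using mass_pos[OF vel_init \<open>B \<noteq> []\<close>] assms(9) by (simp add: M_def)
  \<comment> \<open>This turns the second statement into
    \<open>\<bar>q\<bar> \<le> \<nu>\<^sub>m * M\<close>.\<close>
  have "h = real n / M"
    using mass_two_velocities[OF assms(8)] assms(6,9,10,12,17) by (simp add: M_def)
  then have drift: "\<bar>w - l\<bar> / real n * h \<le> of_int \<nu>\<^sub>m \<longleftrightarrow> \<bar>q\<bar> \<le> of_int \<nu>\<^sub>m * M"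
    using n M by (simp add: q divide_le_eq)
  have F_Suc: "F (Suc t) = bid_step \<sigma> \<gamma> p (F t)" for t by (simp add: F_def)
  have len: "length (F t) = n" for t
    by (induction t) (simp_all add: F_Suc, simp add: F_def assms(9))
  have W': "real (length (F t)) * p = real W" for t using W by (simp add: len)
  have F: "snd ` set (F t) \<subseteq> {\<nu>\<^sub>m, \<nu>\<^sub>p} \<and> bid_velocity_multiset \<gamma> (F t) \<and> mass (F t) {..<n} = M
      \<and> length (velocity_class \<nu>\<^sub>m (F t)) = n\<^sub>m" for t
  proof (induction t)
    case 0
    then show ?case using assms(7,8,10) by (simp add: F_def M_def)
  next
    case (Suc t)
    then show ?case
      using snd_set_bid_step[OF assms(18) W'] bid_velocity_multiset_bid_step[OF assms(18) W']
        mass_bid_step[OF assms(18) W'] length_velocity_class_bid_step[OF assms(18) W']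
      by (simp add: F_Suc len)
  qed
  have vel: "snd x = \<nu>\<^sub>m \<or> snd x = \<nu>\<^sub>p" if "x \<in> set (F t)" for x t using F[of t] that by auto
  have vel_pos: "\<forall>x\<in>set (F t). 0 < snd x" for t using vel assms(5,6) by fastforce
  have "(\<exists>k\<^sub>0 K (N::int). 1 \<le> K \<and> F (k\<^sub>0 + K) = translate (F k\<^sub>0) (\<gamma> * of_int N))
      \<longleftrightarrow> \<bar>q\<bar> \<le> of_int \<nu>\<^sub>m * M"
  proof
    assume "\<exists>k\<^sub>0 K (N::int). 1 \<le> K \<and> F (k\<^sub>0 + K) = translate (F k\<^sub>0) (\<gamma> * of_int N)"
    then obtain k\<^sub>0 K and N :: int where K: "1 \<le> K"
      and per: "F (k\<^sub>0 + K) = translate (F k\<^sub>0) (\<gamma> * of_int N)" by blast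
    \<comment> \<open>The moment change over one period, computed from the dynamics and from the
      translation, gives the mean speed \<open>N / K = q / M\<close>.\<close>
    have "moment (F (k\<^sub>0 + t)) {..<n} = moment (F k\<^sub>0) {..<n} + real t * (\<gamma> * q)" for t
    proof (induction t)
      case (Suc t)
      then show ?case
        using moment_bid_step[OF assms(18) W' _ vel_pos, of "k\<^sub>0 + t" \<gamma>] Wn
        by (simp add: F_Suc len q_def algebra_simps)
    qed simp
    from this[of K] have "\<gamma> * (M * of_int N) = \<gamma> * (real K * q)"
      using moment_translate[of "F k\<^sub>0"] F[of k\<^sub>0] by (simp add: per len mult_ac)
    then have Nq: "M * of_int N = real K * q" using assms(1) by simp
    \<comment> \<open>The slow class is shifted by \<open>\<gamma> * N\<close> as well, but cannot
      travel faster than \<nu>\<open>\<^sub>m\<close>; as it is nonempty,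
      \<open>\<bar>N\<bar> \<le> K * \<nu>\<^sub>m\<close> follows.\<close>
    have "\<bar>class_sum \<nu>\<^sub>m (F (k\<^sub>0 + t)) - class_sum \<nu>\<^sub>m (F k\<^sub>0)\<bar> \<le> real t * (\<gamma> * of_int \<nu>\<^sub>m * real n\<^sub>m)" for t
    proof (induction t)
      case (Suc t)
      then show ?case
        using class_sum_bid_step[OF assms(18) W' assms(1,5), of "k\<^sub>0 + t"] F[of "k\<^sub>0 + t"]
        by (simp add: F_Suc distrib_right)
    qed simp
    from this[of K] have "\<bar>real n\<^sub>m * (\<gamma> * of_int N)\<bar> \<le> real K * (\<gamma> * of_int \<nu>\<^sub>m * real n\<^sub>m)"
      using F[of k\<^sub>0] by (simp add: per class_sum_translate)
    then have "(real n\<^sub>m * \<gamma>) * \<bar>of_int N\<bar> \<le> (real n\<^sub>m * \<gamma>) * (real K * of_int \<nu>\<^sub>m)"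
      using assms(1) by (simp add: abs_mult mult_ac)
    then have "\<bar>of_int N\<bar> \<le> real K * of_int \<nu>\<^sub>m"
      using assms(1,11) by (subst (asm) mult_le_cancel_left_pos) auto
    then have "M * \<bar>of_int N\<bar> \<le> M * (real K * of_int \<nu>\<^sub>m)"
      using M by (intro mult_left_mono) auto
    moreover have "M * \<bar>of_int N\<bar> = real K * \<bar>q\<bar>"
      using Nq M by (metis abs_mult abs_of_nat abs_of_pos)
    ultimately have "real K * \<bar>q\<bar> \<le> real K * (of_int \<nu>\<^sub>m * M)" by (simp add: mult_ac)
    then show "\<bar>q\<bar> \<le> of_int \<nu>\<^sub>m * M" using K by (subst (asm) mult_le_cancel_left_pos) auto
  next
    assume le: "\<bar>q\<bar> \<le> of_int \<nu>\<^sub>m * M"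
    \<comment> \<open>Chosen to exceed \<open>\<gamma> * v\<^sup>2\<close> for both velocities, so
      that minimisers are prefixes; \<open>C\<close> is the minimal energy at time 0.\<close>
    define A where "A = \<gamma> * (of_int \<nu>\<^sub>p)\<^sup>2 + 1"
    define C where "C = Min (energy A B ` Pow {..<n})"
    have A: "\<gamma> * (of_int (snd x))\<^sup>2 < A" if "x \<in> set (F t)" for x t
    proof -
      have "(real_of_int (snd x))\<^sup>2 \<le> (of_int \<nu>\<^sub>p)\<^sup>2"
        using vel[OF that] assms(5,6) by (intro power_mono) auto
      then have "\<gamma> * (real_of_int (snd x))\<^sup>2 \<le> \<gamma> * (of_int \<nu>\<^sub>p)\<^sup>2"
        using assms(1) by (intro mult_left_mono) auto
      then show ?thesis by (simp add: A_def)
    qed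
    have "0 \<le> A" using assms(1) by (simp add: A_def)
    have low: "\<forall>S. S \<subseteq> {..<n} \<longrightarrow> C \<le> energy A (F t) S" for t
    proof (induction t)
      case 0
      then show ?case by (auto simp: F_def C_def intro!: Min_le)
    next
      case (Suc t)
      have slow: "\<forall>x\<in>set (F t). \<nu>\<^sub>m \<le> snd x" using vel assms(6) by fastforce
      have "F t \<noteq> []" using len n by (metis length_greater_0_conv)
      show ?case
        unfolding F_Suc
        using energy_bid_step_lower_bound[OF assms(18,1) W' _ _ assms(5) slow \<open>F t \<noteq> []\<close>, of A C]
          Wn F[of t] A le Suc by (simp add: len q_def bid_velocity_multiset_def)
    qed
    have fast: "\<forall>x\<in>set (F t). snd x \<le> \<nu>\<^sub>p" for t using vel assms(6) by fastforce
    show "\<exists>k\<^sub>0 K (N::int). 1 \<le> K \<and> F (k\<^sub>0 + K) = translate (F k\<^sub>0) (\<gamma> * of_int N)"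
    proof (rule periodic_if_bounded[where V = "{\<nu>\<^sub>m, \<nu>\<^sub>p}" and D = "2 * of_int \<nu>\<^sub>p * (A * M\<^sup>2 - C)"])
      show "\<exists>k::int. fst x = \<gamma> * of_int k" if "x \<in> set (F t)" for t x
        using F[of t] that by (force simp: bid_velocity_multiset_def)
      show "\<bar>fst (F t ! i) - fst (F t ! k)\<bar> \<le> 2 * of_int \<nu>\<^sub>p * (A * M\<^sup>2 - C)" if "i < n" "k < n" for t i k
        using bid_distance_bound[OF vel_pos fast \<open>0 \<le> A\<close>, of t C i k] low that F[of t] by (simp add: len)
    qed (use assms(1) n len F in auto)
  qed
  then show ?thesis by (simp only: drift F_def)
qed

end
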